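(* Let $c\ge 2$ and $h\ge 0$ be fixed natural numbers and let $\alpha\neq 0$ be real. Let $T_{c,h,\alpha}$ be the perfect $c$-ary tree of height $h$ all of whose edge weights equal $\alpha$. Then $g(T_{c,h,\alpha};n)\approx n^{c^h}$.
   Context: A perfect $c$-ary tree of height $h$ is a rooted tree in which every non-leaf vertex has exactly $c$ children and all $c^h$ leaves are at distance exactly $h$ from the root. For an edge-weighted graph $G$ on $m$ vertices with weight function $w$, an $m$-tuple of points $X$ in $\mathbb R^2$ is a dot product $G$-configuration if there is a bijection $\varphi:V(G)\to X$ with $\varphi(u)\cdot\varphi(v)=w(\{u,v\})$ for every edge $\{u,v\}$. $g(G;n)$ is the maximum over all sets of $n$ points in $\mathbb R^2$ of the number of dot product $G$-configurations in the set. $X(n)\approx Y(n)$ means $X(n)\le CY(n)$ and $Y(n)\le CX(n)$ for all $n>N$, with $C,N$ independent of $n$. *)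

theory Defs
  imports "HOL-Analysis.Analysis"
begin

(* A graph is given by a vertex set V and a set E of two-element subsets of V. *)

definition simple_graph :: "'v set \<Rightarrow> 'v set set \<Rightarrow> bool" where
  "simple_graph V E \<longleftrightarrow> finite V \<and> (\<forall>e\<in>E. e \<subseteq> V \<and> card e = 2)"

definition graph_path :: "'v set \<Rightarrow> 'v set set \<Rightarrow> 'v \<Rightarrow> 'v \<Rightarrow> 'v list \<Rightarrow> bool" where
  "graph_path V E u v p \<longleftrightarrow>
     p \<noteq> [] \<and> hd p = u \<and> last p = v \<and> set p \<subseteq> V \<and> distinct p \<and>
     successively (\<lambda>x y. {x, y} \<in> E) p"

definition tree :: "'v set \<Rightarrow> 'v set set \<Rightarrow> bool" where
  "tree V E \<longleftrightarrow> simple_graph V E \<and> V \<noteq> {} \<and> (\<forall>u\<in>V. \<forall>v\<in>V. \<exists>!p. graph_path V E u v p)"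

(* A path with k edges is a list of k + 1 vertices. *)
definition graph_dist :: "'v set \<Rightarrow> 'v set set \<Rightarrow> 'v \<Rightarrow> 'v \<Rightarrow> nat" where
  "graph_dist V E u v = (LEAST k. \<exists>p. graph_path V E u v p \<and> length p = k + 1)"

definition children :: "'v set \<Rightarrow> 'v set set \<Rightarrow> 'v \<Rightarrow> 'v \<Rightarrow> 'v set" where
  "children V E r v =
     {u \<in> V. {v, u} \<in> E \<and> graph_dist V E r u = graph_dist V E r v + 1}"

(* A leaf is a vertex without children; so the root is a leaf if it is the only vertex. *)
definition leaves :: "'v set \<Rightarrow> 'v set set \<Rightarrow> 'v \<Rightarrow> 'v set" where
  "leaves V E r = {v \<in> V. children V E r v = {}}"

definition perfect_tree :: "nat \<Rightarrow> nat \<Rightarrow> 'v set \<Rightarrow> 'v set set \<Rightarrow> 'v \<Rightarrow> bool" where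
  "perfect_tree c h V E r \<longleftrightarrow>
     tree V E \<and> r \<in> V \<and>
     (\<forall>v \<in> V - leaves V E r. card (children V E r v) = c) \<and>
     card (leaves V E r) = c ^ h \<and>
     (\<forall>v \<in> leaves V E r. graph_dist V E r v = h)"

(* Tuples are lists. As the length of xs is card V and set xs is in bijection with V,
   the entries of a configuration are pairwise distinct. *)
definition dot_product_configuration ::
    "'v set \<Rightarrow> 'v set set \<Rightarrow> ('v set \<Rightarrow> real) \<Rightarrow> (real^2) list \<Rightarrow> bool" where
  "dot_product_configuration V E w xs \<longleftrightarrow>
     length xs = card V \<and>
     (\<exists>\<phi>. bij_betw \<phi> V (set xs) \<and>
          (\<forall>u v. {u, v} \<in> E \<longrightarrow> \<phi> u \<bullet> \<phi> v = w {u, v}))"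

definition configuration_count ::
    "'v set \<Rightarrow> 'v set set \<Rightarrow> ('v set \<Rightarrow> real) \<Rightarrow> (real^2) set \<Rightarrow> nat" where
  "configuration_count V E w P =
     card {xs. set xs \<subseteq> P \<and> dot_product_configuration V E w xs}"

definition max_configurations ::
    "'v set \<Rightarrow> 'v set set \<Rightarrow> ('v set \<Rightarrow> real) \<Rightarrow> nat \<Rightarrow> nat" where
  "max_configurations V E w n =
     Max {configuration_count V E w P | P. finite P \<and> card P = n}"

(* The maximum is taken over a finite nonempty set of numbers. *)

lemma configuration_count_le:
  assumes "finite P"
  shows "configuration_count V E w P \<le> card P ^ card V"
proof -
  have "configuration_count V E w P \<le> card {xs. set xs \<subseteq> P \<and> length xs = card V}"
    unfolding configuration_count_def
    by (rule card_mono)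
      (auto simp: dot_product_configuration_def finite_lists_length_eq[OF assms])
  then show ?thesis
    by (simp add: card_lists_length_eq[OF assms])
qed

lemma finite_configuration_counts:
  "finite {configuration_count V E w P | P. finite P \<and> card P = n}"
  by (rule finite_subset[of _ "{..n ^ card V}"]) (auto intro: configuration_count_le)

lemma configuration_counts_nonempty:
  "{configuration_count V E w P | P. finite P \<and> card P = n} \<noteq> {}"
proof -
  have "infinite (UNIV :: (real^2) set)"
    using not_bounded_UNIV finite_imp_bounded by blast
  then obtain P :: "(real^2) set" where "finite P" "card P = n"
    using infinite_arbitrarily_large by blast
  then show ?thesis by blast
qed

definition asymp_equal :: "(nat \<Rightarrow> real) \<Rightarrow> (nat \<Rightarrow> real) \<Rightarrow> bool" where
  "asymp_equal X Y \<longleftrightarrow> (\<exists>C>0. \<exists>N. \<forall>n>N. X n \<le> C * Y n \<and> Y n \<le> C * X n)"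

end

theory Submission imports Defs begin

text \<open>A point of the plane is determined by its dot products, both equal to \<open>\<alpha> \<noteq> 0\<close>, with two
  distinct points, so an embedding of the tree is determined by the images of its leaves; this
  gives the upper bound. For the lower bound, the points whose dot product with a given
  nonzero point is \<open>\<alpha>\<close> form a line, so one can fix distinct images of the non-leaves one after
  another and give each leaf a large pool of points on the line of its parent.\<close>

section \<open>Dot products in the plane and disjoint choices from infinite sets\<close>

text \<open>Both \<open>p\<close> and \<open>p - q\<close> are orthogonal to the nonzero vector
  \<open>x - y\<close>, so in the plane they are parallel. As \<open>p \<bullet> x\<close> is
  nonzero while \<open>(p - q) \<bullet> x\<close> vanishes, the difference is zero.\<close>

lemma eq_if_dot_products_eq:
  fixes p q x y :: "real^2"
  assumes "a \<noteq> 0" "x \<noteq> y"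
    and "p \<bullet> x = a" "p \<bullet> y = a" "q \<bullet> x = a" "q \<bullet> y = a"
  shows "p = q"
proof -
  define d where "d = p - q"
  define e where "e = x - y"
  have dx: "d$1 * x$1 + d$2 * x$2 = 0"
    using assms by (simp add: d_def inner_vec_def sum_2 algebra_simps)
  have de: "d$1 * e$1 + d$2 * e$2 = 0" and pe: "p$1 * e$1 + p$2 * e$2 = 0"
    using assms by (simp_all add: d_def e_def inner_vec_def sum_2 algebra_simps)
  have px: "p$1 * x$1 + p$2 * x$2 = a"
    using assms by (simp add: inner_vec_def sum_2)
  have "e \<noteq> 0"
    using assms by (simp add: e_def)
  then have "e$1 \<noteq> 0 \<or> e$2 \<noteq> 0"
    by (metis exhaust_2 vec_eq_iff zero_index)
  moreover have "e$1 * (d$1 * p$2 - d$2 * p$1) = 0" "e$2 * (d$1 * p$2 - d$2 * p$1) = 0"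
    using de pe by algebra+
  ultimately have parallel: "d$1 * p$2 = d$2 * p$1"
    by auto
  \<comment> \<open>Expanding \<open>a\<close> as \<open>p \<bullet> x\<close> and using
    \<open>parallel\<close> turns \<open>a * d$i\<close> into
    \<open>p$i * (d \<bullet> x)\<close>.\<close>
  have "a * d$1 = 0" "a * d$2 = 0"
    using dx px parallel by algebra+
  then have "d = 0"
    using \<open>a \<noteq> 0\<close> by (simp add: vec_eq_iff forall_2)
  then show ?thesis
    by (simp add: d_def)
qed

lemma infinite_dot_product_line:
  fixes p :: "real^2"
  assumes "p \<noteq> 0"
  shows "infinite {y. p \<bullet> y = a}"
proof -
  define q :: "real^2" where "q = vector [- p$2, p$1]"
  have "q \<noteq> 0"
    using assms by (auto simp: q_def vec_eq_iff forall_2)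
  have "p \<bullet> q = 0"
    by (simp add: q_def inner_vec_def sum_2)
  \<comment> \<open>The foot of the perpendicular from the origin to the line, shifted along
    \<open>q\<close>, which is \<open>p\<close> turned by a right angle.\<close>
  define f where "f t = (a / (p \<bullet> p)) *\<^sub>R p + t *\<^sub>R q" for t
  have "inj f"
    using \<open>q \<noteq> 0\<close> by (auto simp: f_def inj_def)
  then have "infinite (range f)"
    using finite_imageD infinite_UNIV_char_0 by blast
  moreover have "range f \<subseteq> {y. p \<bullet> y = a}"
    using assms \<open>p \<bullet> q = 0\<close> by (auto simp: f_def inner_add_right)
  ultimately show ?thesis
    using finite_subset by blast
qed

text \<open>Greedy choice: for each new index, only finitely many points of an infinite set are
  forbidden, namely \<open>F\<close> and those already chosen. It serves to fill a whole level of
  the tree at once.\<close>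

lemma disjoint_finite_subsets:
  assumes "finite I" "finite F" "\<And>i. i \<in> I \<Longrightarrow> infinite (S i)"
  obtains A where "\<And>i. i \<in> I \<Longrightarrow> A i \<subseteq> S i - F \<and> finite (A i) \<and> card (A i) = m i"
    and "disjoint_family_on A I"
proof -
  have "\<exists>A. (\<forall>i\<in>I. A i \<subseteq> S i - F \<and> finite (A i) \<and> card (A i) = m i) \<and> disjoint_family_on A I"
    using assms(1,3)
  proof (induction I rule: finite_induct)
    case empty
    then show ?case by (simp add: disjoint_family_on_def)
  next
    case (insert j I)
    then obtain A where A: "\<forall>i\<in>I. A i \<subseteq> S i - F \<and> finite (A i) \<and> card (A i) = m i"
      "disjoint_family_on A I"
      by auto
    have "finite (F \<union> (\<Union>i\<in>I. A i))"
      using insert.hyps A assms(2) by auto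
    then have "infinite (S j - (F \<union> (\<Union>i\<in>I. A i)))"
      using insert.prems by (meson Diff_infinite_finite insertI1)
    then obtain B where B: "B \<subseteq> S j - (F \<union> (\<Union>i\<in>I. A i))" "finite B" "card B = m j"
      using infinite_arbitrarily_large by metis
    define A' where "A' = A(j := B)"
    have "\<forall>i\<in>insert j I. A' i \<subseteq> S i - F \<and> finite (A' i) \<and> card (A' i) = m i"
      using A B by (auto simp: A'_def)
    moreover have "disjoint_family_on A' (insert j I)"
      using A(2) B(1) insert.hyps unfolding disjoint_family_on_def A'_def
      by (auto; blast)
    ultimately show ?case by blast
  qed
  then show ?thesis using that by blast
qed

section \<open>Paths, distances and parents in a rooted tree\<close>

lemma tree_simple_graph: "tree V E \<Longrightarrow> simple_graph V E"
  by (simp add: tree_def)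

lemma simple_graph_edgeD:
  assumes "simple_graph V E" "{u, v} \<in> E"
  shows "u \<in> V" "v \<in> V" "u \<noteq> v"
  using assms by (force simp: simple_graph_def)+

lemma graph_path_prefix:
  assumes "graph_path V E u v (xs @ x # ys)"
  shows "graph_path V E u x (xs @ [x])"
  using assms by (auto simp: graph_path_def successively_append_iff hd_append)

lemma graph_path_snoc:
  assumes "graph_path V E u v p" "{v, x} \<in> E" "x \<in> V" "x \<notin> set p"
  shows "graph_path V E u x (p @ [x])"
  using assms by (auto simp: graph_path_def successively_append_iff hd_append)

lemma tree_path_unique:
  assumes "tree V E" "graph_path V E u v p" "graph_path V E u v q"
  shows "p = q"
proof -
  have "u \<in> V" "v \<in> V"
    using assms(2) by (auto simp: graph_path_def)
  then show ?thesis
    using assms unfolding tree_def by blast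
qed

lemma tree_path_exists:
  assumes "tree V E" "u \<in> V" "v \<in> V"
  obtains p where "graph_path V E u v p"
  using assms unfolding tree_def by blast

text \<open>Paths in a tree are unique, so the minimum defining \<open>graph_dist\<close> is taken
  over a single length; \<open>length p\<close> counts vertices, hence the offset.\<close>

lemma tree_graph_dist:
  assumes "tree V E" "graph_path V E u v p"
  shows "graph_dist V E u v + 1 = length p"
proof -
  have "p \<noteq> []"
    using assms by (simp add: graph_path_def)
  have "graph_dist V E u v = length p - 1"
    unfolding graph_dist_def
  proof (rule Least_equality)
    show "\<exists>q. graph_path V E u v q \<and> length q = length p - 1 + 1"
      using assms(2) \<open>p \<noteq> []\<close> by (intro exI[of _ p]) (cases p, auto)
  qed (use tree_path_unique[OF assms(1) assms(2)] in auto)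
  then show ?thesis
    using \<open>p \<noteq> []\<close> by (cases p) auto
qed

text \<open>The vertices of a path are distinct. The bound is strict so that
  \<open>card V - graph_dist V E r v\<close> decreases from parent to child and the levels below
  \<open>card V\<close> exhaust the tree.\<close>

lemma tree_graph_dist_less_card:
  assumes "tree V E" "u \<in> V" "v \<in> V"
  shows "graph_dist V E u v < card V"
proof -
  obtain p where p: "graph_path V E u v p"
    using tree_path_exists[OF assms] .
  have "finite V"
    using assms(1) by (simp add: tree_def simple_graph_def)
  then have "length p \<le> card V"
    using p by (metis card_mono distinct_card graph_path_def)
  then show ?thesis
    using tree_graph_dist[OF assms(1) p] by linarith
qed

text \<open>If \<open>v\<close> is off \<open>p\<close>, appending it gives the path to
  \<open>v\<close>. Otherwise the prefix of \<open>p\<close> ending at \<open>v\<close> is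
  \<open>q\<close>; it misses \<open>u\<close>, the last vertex of \<open>p\<close>, so appending
  \<open>u\<close> gives the path to \<open>u\<close>.\<close>

lemma tree_edge_paths:
  assumes T: "tree V E" and e: "{u, v} \<in> E"
    and p: "graph_path V E r u p" and q: "graph_path V E r v q"
  shows "q = p @ [v] \<or> p = q @ [u]"
proof (cases "v \<in> set p")
  case False
  have "v \<in> V"
    using simple_graph_edgeD[OF tree_simple_graph[OF T] e] by simp
  then have "q = p @ [v]"
    using tree_path_unique[OF T q graph_path_snoc[OF p e _ False]] by blast
  then show ?thesis ..
next
  case True
  then obtain xs ys where pxy: "p = xs @ v # ys"
    by (meson split_list)
  have q_eq: "q = xs @ [v]"
    using tree_path_unique[OF T q graph_path_prefix] p pxy by blast
  have uv: "u \<in> V" "u \<noteq> v"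
    using simple_graph_edgeD[OF tree_simple_graph[OF T] e] by auto
  have "last p = u" "distinct p"
    using p by (auto simp: graph_path_def)
  then have "u \<notin> set q"
    using pxy q_eq uv by (cases ys rule: rev_cases) auto
  moreover have "{v, u} \<in> E"
    using e by (simp add: insert_commute)
  ultimately have "p = q @ [u]"
    using tree_path_unique[OF T p graph_path_snoc[OF q _ uv(1)]] by blast
  then show ?thesis ..
qed

lemma childrenD:
  assumes "v \<in> children V E r u"
  shows "{u, v} \<in> E" "v \<in> V" "graph_dist V E r v = graph_dist V E r u + 1"
  using assms by (auto simp: children_def)

text \<open>The root paths of the two ends differ by one final vertex, so the distances differ by
  one. Edge conditions thus reduce to parent-child pairs.\<close>

lemma tree_edge_children:
  assumes T: "tree V E" and r: "r \<in> V" and e: "{u, v} \<in> E"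
  shows "v \<in> children V E r u \<or> u \<in> children V E r v"
proof -
  have uv: "u \<in> V" "v \<in> V"
    using simple_graph_edgeD[OF tree_simple_graph[OF T] e] by auto
  obtain p q where pq: "graph_path V E r u p" "graph_path V E r v q"
    using tree_path_exists[OF T r] uv by metis
  have "q = p @ [v] \<or> p = q @ [u]"
    using tree_edge_paths[OF T e pq] .
  moreover note tree_graph_dist[OF T pq(1)] tree_graph_dist[OF T pq(2)]
  ultimately show ?thesis
    using uv e by (auto simp: children_def insert_commute)
qed

text \<open>The root path of any parent is the root path of \<open>v\<close> without its last
  vertex, and that path is unique.\<close>

lemma tree_parent_unique:
  assumes T: "tree V E" and r: "r \<in> V"
    and "v \<in> children V E r u" "v \<in> children V E r u'"
  shows "u = u'"
proof -
  have "v \<in> V"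
    using assms(3) by (rule childrenD)
  then obtain q where q: "graph_path V E r v q"
    using tree_path_exists[OF T r] by metis
  have "\<exists>p. graph_path V E r z p \<and> q = p @ [v]" if z: "v \<in> children V E r z" for z
  proof -
    have "z \<in> V"
      using simple_graph_edgeD[OF tree_simple_graph[OF T] childrenD(1)[OF z]] by simp
    then obtain p where p: "graph_path V E r z p"
      using tree_path_exists[OF T r] by metis
    \<comment> \<open>The wrong orientation is excluded by length: \<open>v\<close> is farther from
      the root than \<open>z\<close>.\<close>
    have "p \<noteq> q @ [z]"
      using tree_graph_dist[OF T p] tree_graph_dist[OF T q] childrenD(3)[OF z] by auto
    then show ?thesis
      using tree_edge_paths[OF T childrenD(1)[OF z] p q] p by blast
  qed
  then obtain p p' where "graph_path V E r u p" "q = p @ [v]"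
    "graph_path V E r u' p'" "q = p' @ [v]"
    using assms by metis
  then show ?thesis
    by (auto simp: graph_path_def)
qed

section \<open>Counting embeddings instead of tuples\<close>

text \<open>Functions are extensional, so that values outside \<open>V\<close> do not multiply the
  count.\<close>

definition embeddings ::
    "'v set \<Rightarrow> 'v set set \<Rightarrow> ('v set \<Rightarrow> real) \<Rightarrow> (real^2) set \<Rightarrow> ('v \<Rightarrow> real^2) set" where
  "embeddings V E w P = {\<phi> \<in> V \<rightarrow>\<^sub>E P. inj_on \<phi> V \<and> (\<forall>u v. {u, v} \<in> E \<longrightarrow> \<phi> u \<bullet> \<phi> v = w {u, v})}"

lemma finite_embeddings: "finite V \<Longrightarrow> finite P \<Longrightarrow> finite (embeddings V E w P)"
  unfolding embeddings_def by (rule finite_subset[of _ "V \<rightarrow>\<^sub>E P"]) (auto intro: finite_PiE)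

lemma finite_configurations:
  assumes "finite P"
  shows "finite {xs. set xs \<subseteq> P \<and> dot_product_configuration V E w xs}"
  by (rule finite_subset[OF _ finite_lists_length_eq[OF assms, of "card V"]])
    (auto simp: dot_product_configuration_def)

text \<open>A configuration arises from an embedding and an ordering of the vertices. Counting all
  vertex lists of length \<open>card V\<close> in place of the orderings still costs only a factor
  independent of \<open>P\<close>.\<close>

lemma configuration_count_le_embeddings:
  assumes G: "simple_graph V E" and P: "finite P"
  shows "configuration_count V E w P \<le> card V ^ card V * card (embeddings V E w P)"
proof -
  have V: "finite V"
    using G by (simp add: simple_graph_def)
  let ?L = "{vs. set vs \<subseteq> V \<and> length vs = card V}"
  let ?f = "\<lambda>(vs, \<phi>). map \<phi> vs"
  have fin: "finite (?L \<times> embeddings V E w P)"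
    using V P by (intro finite_cartesian_product finite_lists_length_eq finite_embeddings)
  have "{xs. set xs \<subseteq> P \<and> dot_product_configuration V E w xs} \<subseteq> ?f ` (?L \<times> embeddings V E w P)"
  proof
    fix xs
    assume "xs \<in> {xs. set xs \<subseteq> P \<and> dot_product_configuration V E w xs}"
    then obtain \<phi> where xs: "set xs \<subseteq> P" "length xs = card V"
      and bij: "bij_betw \<phi> V (set xs)"
      and edges: "\<And>u v. {u, v} \<in> E \<Longrightarrow> \<phi> u \<bullet> \<phi> v = w {u, v}"
      by (auto simp: dot_product_configuration_def)
    \<comment> \<open>The ordering of \<open>V\<close> in which \<open>\<phi>\<close> has to be read
      to give back the tuple \<open>xs\<close>.\<close>
    define vs where "vs = map (inv_into V \<phi>) xs"
    have img: "\<phi> ` V = set xs"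
      using bij by (simp add: bij_betw_def)
    have vs: "set vs \<subseteq> V" "length vs = card V"
      using img xs by (auto simp: vs_def inv_into_into)
    have "map (restrict \<phi> V) vs = map \<phi> vs"
      using vs by (auto simp: subset_iff)
    also have "\<dots> = xs"
      using img by (auto simp: vs_def f_inv_into_f intro!: map_idI)
    finally have "xs = ?f (vs, restrict \<phi> V)"
      by simp
    moreover have "restrict \<phi> V \<in> embeddings V E w P"
      using bij xs img edges simple_graph_edgeD[OF G]
      by (auto simp: embeddings_def bij_betw_def)
    ultimately show "xs \<in> ?f ` (?L \<times> embeddings V E w P)"
      using vs by blast
  qed
  then have "configuration_count V E w P \<le> card (?L \<times> embeddings V E w P)"
    unfolding configuration_count_def using fin by (rule surj_card_le[rotated])
  then show ?thesis
    using V by (simp add: card_cartesian_product card_lists_length_eq)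
qed

text \<open>Reading embeddings along one fixed enumeration of \<open>V\<close> is injective and
  yields configurations.\<close>

lemma card_embeddings_le_configuration_count:
  assumes V: "finite V" and P: "finite P"
  shows "card (embeddings V E w P) \<le> configuration_count V E w P"
proof -
  obtain vs where vs: "set vs = V" "distinct vs"
    using finite_distinct_list[OF V] by blast
  let ?f = "\<lambda>\<phi>. map \<phi> vs"
  have "inj_on ?f (embeddings V E w P)"
    using vs by (intro inj_onI) (auto simp: embeddings_def intro: PiE_ext)
  moreover have "?f ` embeddings V E w P
      \<subseteq> {xs. set xs \<subseteq> P \<and> dot_product_configuration V E w xs}"
  proof (intro image_subsetI CollectI conjI)
    fix \<phi>
    assume \<phi>: "\<phi> \<in> embeddings V E w P"
    then show "set (map \<phi> vs) \<subseteq> P"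
      using vs by (auto simp: embeddings_def)
    have "length (map \<phi> vs) = card V"
      using vs distinct_card by fastforce
    moreover have "bij_betw \<phi> V (set (map \<phi> vs))"
      using \<phi> vs by (simp add: embeddings_def bij_betw_def)
    moreover have "\<forall>u v. {u, v} \<in> E \<longrightarrow> \<phi> u \<bullet> \<phi> v = w {u, v}"
      using \<phi> by (simp add: embeddings_def)
    ultimately show "dot_product_configuration V E w (map \<phi> vs)"
      unfolding dot_product_configuration_def by blast
  qed
  ultimately show ?thesis
    unfolding configuration_count_def using finite_configurations[OF P]
    by (rule card_inj_on_le)
qed

section \<open>Upper bound: recovering an embedding from its leaves\<close>

lemma embedding_determined_by_leaves:
  assumes T: "tree V E" and r: "r \<in> V"
    and two: "\<And>v. v \<in> V - leaves V E r \<Longrightarrow> card (children V E r v) \<ge> 2"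
    and w: "\<And>e. e \<in> E \<Longrightarrow> w e = a" and "a \<noteq> 0"
    and \<phi>: "\<phi> \<in> embeddings V E w P" and \<psi>: "\<psi> \<in> embeddings V E w P"
    and leaves: "\<And>v. v \<in> leaves V E r \<Longrightarrow> \<phi> v = \<psi> v"
  shows "\<phi> = \<psi>"
proof -
  have "\<phi> v = \<psi> v" if "v \<in> V" for v
    using that
  \<comment> \<open>The measure decreases from a vertex to its children, so images are recovered
    from the deepest level up to the root.\<close>
  proof (induction "card V - graph_dist V E r v" arbitrary: v rule: less_induct)
    case less
    show ?case
    proof (cases "v \<in> leaves V E r")
      case False
      then have card: "2 \<le> card (children V E r v)"
        using two[of v] less.prems by simp
      then have "finite (children V E r v)"
        by (intro card_ge_0_finite) simp
      then obtain x y where xy: "x \<in> children V E r v" "y \<in> children V E r v" "x \<noteq> y"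
        using card card_le_Suc0_iff_eq[of "children V E r v"] by fastforce
      \<comment> \<open>The last equation has \<open>\<phi> z\<close> instead of
        \<open>\<psi> z\<close>, so that both images of \<open>v\<close> are tested against the same
        points.\<close>
      have eq: "\<phi> z = \<psi> z" "\<phi> v \<bullet> \<phi> z = a" "\<psi> v \<bullet> \<phi> z = a" if z: "z \<in> children V E r v" for z
      proof -
        show *: "\<phi> z = \<psi> z"
          using less.hyps[of z] childrenD[OF z] tree_graph_dist_less_card[OF T r less.prems]
          by simp
        have e: "{v, z} \<in> E"
          using childrenD(1)[OF z] .
        have "\<phi> v \<bullet> \<phi> z = w {v, z}" "\<psi> v \<bullet> \<psi> z = w {v, z}"
          using \<phi> \<psi> e unfolding embeddings_def by blast+
        then show "\<phi> v \<bullet> \<phi> z = a" "\<psi> v \<bullet> \<phi> z = a"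
          using w[OF e] * by simp_all
      qed
      have "\<phi> x \<noteq> \<phi> y"
        using \<phi> xy childrenD(2)[OF xy(1)] childrenD(2)[OF xy(2)]
        by (auto simp: embeddings_def dest: inj_onD)
      then show ?thesis
        using eq_if_dot_products_eq[OF \<open>a \<noteq> 0\<close>] eq(2,3)[OF xy(1)] eq(2,3)[OF xy(2)]
        by simp
    qed (use leaves in auto)
  qed
  then show ?thesis
    using \<phi> \<psi> by (auto simp: embeddings_def intro: PiE_ext)
qed

text \<open>Restriction to the leaves is injective on embeddings, and the restrictions are maps from
  the leaves into \<open>P\<close>.\<close>

lemma card_embeddings_le:
  assumes T: "tree V E" and r: "r \<in> V"
    and two: "\<And>v. v \<in> V - leaves V E r \<Longrightarrow> card (children V E r v) \<ge> 2"
    and w: "\<And>e. e \<in> E \<Longrightarrow> w e = a" and "a \<noteq> 0" and P: "finite P"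
  shows "card (embeddings V E w P) \<le> card P ^ card (leaves V E r)"
proof -
  let ?L = "leaves V E r"
  have "?L \<subseteq> V"
    by (auto simp: leaves_def)
  then have L: "finite ?L"
    using T by (auto simp: tree_def simple_graph_def intro: finite_subset)
  have "inj_on (\<lambda>\<phi>. restrict \<phi> ?L) (embeddings V E w P)"
  proof (rule inj_onI)
    fix \<phi> \<psi>
    assume "\<phi> \<in> embeddings V E w P" "\<psi> \<in> embeddings V E w P"
      and eq: "restrict \<phi> ?L = restrict \<psi> ?L"
    moreover have "\<phi> v = \<psi> v" if "v \<in> ?L" for v
      using fun_cong[OF eq, of v] that by simp
    ultimately show "\<phi> = \<psi>"
      using two w \<open>a \<noteq> 0\<close> by (intro embedding_determined_by_leaves[OF T r])
  qed
  moreover have "(\<lambda>\<phi>. restrict \<phi> ?L) ` embeddings V E w P \<subseteq> ?L \<rightarrow>\<^sub>E P"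
    using \<open>?L \<subseteq> V\<close> by (auto simp: embeddings_def PiE_def Pi_def)
  moreover have "finite (?L \<rightarrow>\<^sub>E P)"
    using L P by (intro finite_PiE)
  ultimately have "card (embeddings V E w P) \<le> card (?L \<rightarrow>\<^sub>E P)"
    by (rule card_inj_on_le)
  then show ?thesis
    using L by (simp add: card_funcsetE)
qed

section \<open>Lower bound: a point set with many embeddings\<close>

text \<open>The sets \<open>A v\<close> are chosen level by level: a vertex has at most one parent, which is
  represented by a single nonzero point, so that the points available to the vertex form a line.\<close>

lemma tree_blowup:
  assumes T: "tree V E" and r: "r \<in> V" and "a \<noteq> 0"
    and m: "\<And>u v. v \<in> children V E r u \<Longrightarrow> m u = 1"
  obtains A :: "'v \<Rightarrow> (real^2) set"
  where "\<And>v. v \<in> V \<Longrightarrow> finite (A v) \<and> card (A v) = m v"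
    and "disjoint_family_on A V"
    and "\<And>u v x y. {u, v} \<in> E \<Longrightarrow> x \<in> A u \<Longrightarrow> y \<in> A v \<Longrightarrow> x \<bullet> y = a"
proof -
  let ?d = "graph_dist V E r"
  let ?U = "\<lambda>k. {v \<in> V. ?d v < k}"
  have V: "finite V"
    using T by (simp add: tree_def simple_graph_def)
  \<comment> \<open>Invariant for the levels below \<open>k\<close>. Excluding 0 ensures that the
    point of a parent defines a line for its children on the next level.\<close>
  let ?blowup = "\<lambda>k A. (\<forall>v\<in>?U k. finite (A v) \<and> card (A v) = m v \<and> 0 \<notin> A v)
    \<and> disjoint_family_on A (?U k)
    \<and> (\<forall>u v. v \<in> children V E r u \<longrightarrow> v \<in> ?U k \<longrightarrow> (\<forall>x\<in>A u. \<forall>y\<in>A v. x \<bullet> y = a))"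
  have blowup: "\<exists>A :: 'v \<Rightarrow> (real^2) set. ?blowup k A" for k
  proof (induction k)
    case 0
    then show ?case by (simp add: disjoint_family_on_def)
  next
    case (Suc k)
    then obtain A :: "'v \<Rightarrow> (real^2) set"
      where A1: "\<And>v. v \<in> ?U k \<Longrightarrow> finite (A v) \<and> card (A v) = m v \<and> 0 \<notin> A v"
        and A2: "disjoint_family_on A (?U k)"
        and A3: "\<And>u v x y. v \<in> children V E r u \<Longrightarrow> v \<in> ?U k \<Longrightarrow> x \<in> A u \<Longrightarrow> y \<in> A v \<Longrightarrow> x \<bullet> y = a"
      by blast
    let ?N = "{v \<in> V. ?d v = k}"
    \<comment> \<open>The points compatible with the parent of \<open>v\<close>: a line, or the
      whole plane if \<open>v\<close> has no parent.\<close>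
    define S where "S v = {y. \<forall>u. v \<in> children V E r u \<longrightarrow> (\<forall>x\<in>A u. x \<bullet> y = a)}" for v
    have inf: "infinite (S v)" if v: "v \<in> ?N" for v
    proof (cases "\<exists>u. v \<in> children V E r u")
      case True
      then obtain u where u: "v \<in> children V E r u" ..
      have "u \<in> ?U k"
        using v childrenD[OF u] simple_graph_edgeD[OF tree_simple_graph[OF T] childrenD(1)[OF u]]
        by simp
      then have "card (A u) = 1" "0 \<notin> A u"
        using A1 m[OF u] by auto
      then obtain x where x: "A u = {x}" "x \<noteq> 0"
        by (metis card_1_singletonE singletonI)
      have "v \<in> children V E r u' \<longleftrightarrow> u' = u" for u'
        using tree_parent_unique[OF T r _ u] u by blast
      then have "S v = {y. x \<bullet> y = a}"
        by (simp add: S_def x)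
      then show ?thesis
        using infinite_dot_product_line[OF x(2)] by simp
    next
      case False
      then have "S v = UNIV"
        by (simp add: S_def)
      moreover have "infinite (UNIV :: (real^2) set)"
        using not_bounded_UNIV finite_imp_bounded by blast
      ultimately show ?thesis
        by simp
    qed
    \<comment> \<open>Besides 0, all points used on earlier levels are avoided, which keeps the new
      sets disjoint from the old ones.\<close>
    let ?F = "insert 0 (\<Union>v\<in>?U k. A v)"
    have "finite ?F" "finite ?N"
      using V A1 by auto
    then obtain B where B1: "\<And>v. v \<in> ?N \<Longrightarrow> B v \<subseteq> S v - ?F \<and> finite (B v) \<and> card (B v) = m v"
      and B2: "disjoint_family_on B ?N"
      using disjoint_finite_subsets[of ?N ?F S m, OF _ _ inf] by blast
    define C where "C v = (if ?d v = k then B v else A v)" for v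
    have *: "\<forall>v\<in>?U (Suc k). finite (C v) \<and> card (C v) = m v \<and> 0 \<notin> C v"
    proof
      fix v
      assume "v \<in> ?U (Suc k)"
      then show "finite (C v) \<and> card (C v) = m v \<and> 0 \<notin> C v"
        using A1[of v] B1[of v] by (auto simp: C_def)
    qed
    have AB: "A u \<inter> B v = {}" if "u \<in> ?U k" "v \<in> ?N" for u v
      using B1[OF that(2)] that(1) by blast
    have "disjoint_family_on C (?U (Suc k))"
      unfolding disjoint_family_on_def
    proof (intro ballI impI)
      fix u v
      assume uv: "u \<in> ?U (Suc k)" "v \<in> ?U (Suc k)" "u \<noteq> v"
      show "C u \<inter> C v = {}"
        using uv AB[of u v] AB[of v u] disjoint_family_onD[OF A2, of u v]
          disjoint_family_onD[OF B2, of u v]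
        by (cases "?d u = k"; cases "?d v = k") (auto simp: C_def)
    qed
    moreover have "x \<bullet> y = a"
      if v: "v \<in> children V E r u" "v \<in> ?U (Suc k)" and xy: "x \<in> C u" "y \<in> C v" for u v x y
    proof -
      \<comment> \<open>The parent lies on a level strictly below \<open>k\<close>, where
        \<open>C\<close> agrees with \<open>A\<close>.\<close>
      have u: "?d v = ?d u + 1"
        using childrenD(3)[OF v(1)] .
      then have x: "x \<in> A u"
        using v(2) xy(1) by (simp add: C_def)
      show ?thesis
      proof (cases "?d v = k")
        case True
        then have "y \<in> S v"
          using B1[of v] v(2) xy(2) by (auto simp: C_def)
        then show ?thesis
          using v(1) x by (auto simp: S_def)
      next
        case False
        then show ?thesis
          using A3[OF v(1) _ x] v(2) xy(2) by (simp add: C_def)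
      qed
    qed
    ultimately show ?case
      using * by blast
  qed
  have U: "?U (card V) = V"
    using tree_graph_dist_less_card[OF T r] by blast
  obtain A :: "'v \<Rightarrow> (real^2) set" where A: "?blowup (card V) A"
    using blowup[of "card V"] by (rule exE)
  have A1: "finite (A v) \<and> card (A v) = m v" if "v \<in> V" for v
    using A that unfolding U by simp
  have A2: "disjoint_family_on A V"
    using A unfolding U by simp
  have A3: "x \<bullet> y = a" if "v \<in> children V E r u" "x \<in> A u" "y \<in> A v" for u v x y
    using A that childrenD(2)[OF that(1)] unfolding U by simp
  show ?thesis
  proof
    show "finite (A v) \<and> card (A v) = m v" if "v \<in> V" for v
      using A1 that .
    show "disjoint_family_on A V"
      using A2 .
    show "x \<bullet> y = a" if e: "{u, v} \<in> E" and xy: "x \<in> A u" "y \<in> A v" for u v x y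
      using tree_edge_children[OF T r e]
    proof
      assume "v \<in> children V E r u"
      then show ?thesis
        using A3 xy by simp
    next
      assume "u \<in> children V E r v"
      then have "y \<bullet> x = a"
        using A3 xy by simp
      then show ?thesis
        by (simp add: inner_commute)
    qed
  qed
qed

text \<open>Every choice of one point from each pool is an embedding, and only the leaves contribute
  a factor \<open>m\<close> to the number of choices. All pools together have at most
  \<open>m * card V\<close> points, hence fit into \<open>n\<close>.\<close>

lemma embeddings_lower_bound:
  fixes V :: "'v set"
  assumes T: "tree V E" and r: "r \<in> V"
    and w: "\<And>e. e \<in> E \<Longrightarrow> w e = a" and "a \<noteq> 0" and "m > 0" and n: "m * card V \<le> n"
  obtains P :: "(real^2) set" where "finite P" "card P = n"
    "m ^ card (leaves V E r) \<le> card (embeddings V E w P)"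
proof -
  let ?L = "leaves V E r"
  have G: "simple_graph V E" and V: "finite V"
    using T by (auto simp: tree_def simple_graph_def)
  have LV: "?L \<subseteq> V"
    by (auto simp: leaves_def)
  define k where "k v = (if v \<in> ?L then m else 1)" for v
  have "k u = 1" if "v \<in> children V E r u" for u v
    using that by (auto simp: k_def leaves_def)
  then obtain A :: "'v \<Rightarrow> (real^2) set"
    where A1: "\<And>v. v \<in> V \<Longrightarrow> finite (A v) \<and> card (A v) = k v"
      and A2: "disjoint_family_on A V"
      and A3: "\<And>u v x y. {u, v} \<in> E \<Longrightarrow> x \<in> A u \<Longrightarrow> y \<in> A v \<Longrightarrow> x \<bullet> y = a"
    using tree_blowup[OF T r \<open>a \<noteq> 0\<close>, of k] by metis
  let ?Q = "\<Union>v\<in>V. A v"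
  have "card ?Q \<le> (\<Sum>v\<in>V. card (A v))"
    using V by (rule card_UN_le)
  also have "\<dots> \<le> (\<Sum>v\<in>V. m)"
    using A1 \<open>m > 0\<close> by (intro sum_mono) (auto simp: k_def)
  also have "\<dots> \<le> n"
    using n by (simp add: mult.commute)
  finally have Qn: "card ?Q \<le> n" .
  have Q: "finite ?Q"
    using V A1 by auto
  \<comment> \<open>Arbitrary further points pad the union of the pools to exactly \<open>n\<close>
    points; this loses no embedding.\<close>
  have "infinite (UNIV :: (real^2) set)"
    using not_bounded_UNIV finite_imp_bounded by blast
  then have "infinite (- ?Q)"
    using Q by (metis finite_compl)
  then obtain R where R: "R \<subseteq> - ?Q" "finite R" "card R = n - card ?Q"
    using infinite_arbitrarily_large by metis
  define P where "P = ?Q \<union> R"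
  have P: "finite P" "card P = n"
    using Q Qn R card_Un_disjoint[of ?Q R] unfolding P_def by auto
  have "(V \<rightarrow>\<^sub>E P) \<inter> Pi V A \<subseteq> embeddings V E w P"
  proof
    fix \<phi>
    assume \<phi>: "\<phi> \<in> (V \<rightarrow>\<^sub>E P) \<inter> Pi V A"
    \<comment> \<open>Distinct vertices take their values in disjoint pools.\<close>
    have "inj_on \<phi> V"
      using \<phi> disjoint_family_onD[OF A2] by (fastforce intro!: inj_onI)
    moreover have "\<phi> u \<bullet> \<phi> v = w {u, v}" if "{u, v} \<in> E" for u v
      using A3[OF that] w[OF that] \<phi> simple_graph_edgeD[OF G that] by (auto simp: Pi_def)
    ultimately show "\<phi> \<in> embeddings V E w P"
      using \<phi> by (simp add: embeddings_def)
  qed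
  moreover have "Pi\<^sub>E V A = (V \<rightarrow>\<^sub>E P) \<inter> Pi V A"
    by (auto simp: PiE_def Pi_def P_def)
  ultimately have "card (Pi\<^sub>E V A) \<le> card (embeddings V E w P)"
    using finite_embeddings[OF V P(1)] by (metis card_mono)
  moreover have "card (Pi\<^sub>E V A) = (\<Prod>v\<in>V. k v)"
    using A1 V by (simp add: card_PiE)
  moreover have "(\<Prod>v\<in>V. k v) = (\<Prod>v\<in>?L. m)"
    using V LV unfolding k_def by (simp add: prod.If_cases Int_absorb1)
  ultimately show ?thesis
    using that P by simp
qed

section \<open>The maximum and its order of growth\<close>

lemma max_configurations_le:
  assumes "\<And>P. finite P \<Longrightarrow> card P = n \<Longrightarrow> configuration_count V E w P \<le> k"
  shows "max_configurations V E w n \<le> k"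
  unfolding max_configurations_def
  by (rule Max.boundedI[OF finite_configuration_counts configuration_counts_nonempty])
    (use assms in auto)

lemma configuration_count_le_max_configurations:
  assumes "finite P" "card P = n"
  shows "configuration_count V E w P \<le> max_configurations V E w n"
  unfolding max_configurations_def
  by (rule Max_ge[OF finite_configuration_counts]) (use assms in blast)

theorem mainTheorem4:
  fixes c h :: nat and \<alpha> :: real
    and V :: "'v set" and E :: "'v set set" and r :: 'v and w :: "'v set \<Rightarrow> real"
  assumes "c \<ge> 2"
    and "\<alpha> \<noteq> 0"
    and "perfect_tree c h V E r"
    and "\<forall>e\<in>E. w e = \<alpha>"
  shows "asymp_equal (\<lambda>n. real (max_configurations V E w n)) (\<lambda>n. real n ^ (c ^ h))"
proof -
  have T: "tree V E" and r: "r \<in> V" and L: "card (leaves V E r) = c ^ h"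
    and two: "\<And>v. v \<in> V - leaves V E r \<Longrightarrow> card (children V E r v) \<ge> 2"
    using assms(1,3) unfolding perfect_tree_def by simp_all
  have w: "\<And>e. e \<in> E \<Longrightarrow> w e = \<alpha>"
    using assms by blast
  have G: "simple_graph V E" and V: "finite V"
    using T by (auto simp: tree_def simple_graph_def)
  let ?v = "card V"
  have v: "?v > 0"
    using V r by (auto simp: card_gt_0_iff)
  \<comment> \<open>The first entry absorbs the count of vertex lists in the upper bound, the second
    the rounding loss in the lower bound.\<close>
  define C where "C = max (?v ^ ?v) ((2 * ?v) ^ (c ^ h))"
  have upper: "max_configurations V E w n \<le> C * n ^ (c ^ h)" for n
  proof (rule max_configurations_le)
    fix P :: "(real^2) set"
    assume P: "finite P" "card P = n"
    have "configuration_count V E w P \<le> ?v ^ ?v * card (embeddings V E w P)"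
      using configuration_count_le_embeddings[OF G P(1)] .
    also have "\<dots> \<le> C * n ^ (c ^ h)"
      using card_embeddings_le[OF T r two w \<open>\<alpha> \<noteq> 0\<close> P(1)] P(2) L
      by (intro mult_mono) (simp_all add: C_def)
    finally show "configuration_count V E w P \<le> C * n ^ (c ^ h)" .
  qed
  have lower: "n ^ (c ^ h) \<le> C * max_configurations V E w n" if "n > ?v" for n
  proof -
    \<comment> \<open>The largest pool size for which \<open>card V\<close> pools fit into
      \<open>n\<close> points; \<open>n > ?v\<close> makes it positive and is also the threshold in
      \<open>asymp_equal\<close>.\<close>
    define m where "m = n div ?v"
    have m: "m > 0" "m * ?v \<le> n"
      using that v by (auto simp: m_def div_greater_zero_iff)
    have "n < (m + 1) * ?v"
      using dividend_less_div_times[OF v, of n] by (simp add: m_def algebra_simps)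
    \<comment> \<open>As \<open>m\<close> is at least 1, rounding down costs at most a factor
      2.\<close>
    also have "\<dots> \<le> (2 * m) * ?v"
      using m(1) by (intro mult_right_mono) simp_all
    also have "\<dots> = 2 * ?v * m"
      by (simp only: mult_ac)
    finally have "n \<le> 2 * ?v * m"
      by (rule less_imp_le)
    then have "n ^ (c ^ h) \<le> (2 * ?v * m) ^ (c ^ h)"
      by (rule power_mono) simp
    also have "\<dots> = (2 * ?v) ^ (c ^ h) * m ^ (c ^ h)"
      by (rule power_mult_distrib)
    also have "\<dots> \<le> C * max_configurations V E w n"
    proof (intro mult_mono)
      obtain P :: "(real^2) set" where P: "finite P" "card P = n"
        and le: "m ^ (c ^ h) \<le> card (embeddings V E w P)"
        by (rule embeddings_lower_bound[of V E r w \<alpha> m n, OF T r w \<open>\<alpha> \<noteq> 0\<close> m, unfolded L])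
      note le
      also have "card (embeddings V E w P) \<le> configuration_count V E w P"
        using card_embeddings_le_configuration_count[OF V P(1)] .
      also have "\<dots> \<le> max_configurations V E w n"
        using configuration_count_le_max_configurations[OF P] .
      finally show "m ^ (c ^ h) \<le> max_configurations V E w n" .
    qed (auto simp: C_def)
    finally show ?thesis .
  qed
  have "real C > 0"
    using v by (simp add: C_def max_def)
  moreover have "real (max_configurations V E w n) \<le> real C * real n ^ (c ^ h)" for n
    using of_nat_mono[OF upper[of n], where ?'a = real] by simp
  moreover have "real n ^ (c ^ h) \<le> real C * real (max_configurations V E w n)" if "n > ?v" for n
    using of_nat_mono[OF lower[OF that], where ?'a = real] by simp
  ultimately show ?thesis
    unfolding asymp_equal_def by blast
qed

end
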